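(* Let $K$ be a field of characteristic zero, let $X=\{x,y\}$, let $k\geq 2$ be an integer, and in the free associative algebra $K\langle x,y\rangle$ let \[ u=(xy)^kx,\quad v=xy,\quad w=yx, \] \[ g=u^2+s,\quad s=v+w. \] Then $g$ generates its centralizer $C(g)$ in $K\langle x,y\rangle$, and its homogeneous component of maximal degree is a square in $K\langle x,y\rangle$. If $\rho\in\mathcal{A}(x,y)$ is such that $g=\rho^2$, then $\rho^3$ has no monomial of positive degree containing a negative power of $x$ or $y$.
   Context: $K\langle x,y\rangle$ is the free associative unital $K$-algebra on $x,y$. The centralizer $C(g)$ is the set of all elements of $K\langle x,y\rangle$ commuting with $g$; "$g$ generates its centralizer" means $C(g)=K[g]$, the unital subalgebra generated by $g$. Let $F(X)$ be the free group generated by $X=\{x,y\}$, with total degree $\deg:F(X)\to\mathbb{Z}$ the group homomorphism with $\deg(x)=\deg(y)=1$ (so $\deg(x^{-1})=\deg(y^{-1})=-1$). Fix a linear order on $F(X)$ making it an ordered group (the order is compatible with left and right multiplication) and such that $\deg(u_1)<\deg(u_2)$ implies $u_1<u_2$ (such orders exist). The Malcev--Neumann algebra $\mathcal{A}(X)=\mathcal{A}(x,y)$ of formal power series consists of all formal sums $\tau=\sum_{z\in\Delta}\alpha_z z$ with $\alpha_z\in K$, where $\Delta\subseteq F(X)$ is well ordered relative to the opposite ordering, i.e. every nonempty subset of $\Delta$ has a largest element; addition is termwise and multiplication extends that of $F(X)$. It contains $K\langle x,y\rangle$. The monomials of $\tau$ are the elements $z\in F(X)$ (written as reduced words) occurring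 in $\tau$ with nonzero coefficient; a monomial contains a negative power of a generator if its reduced word contains $x^{-1}$ or $y^{-1}$. *)

theory Defs
  imports "HOL-Library.Poly_Mapping" "HOL-Algebra.Group" "HOL-Algebra.Ring" "HOL.Hull"
begin

section \<open>The free associative algebra\<close>

text \<open>
  Words are lists, and concatenation is written additively because the convolution product
  of \<^theory>\<open>HOL-Library.Poly_Mapping\<close> is indexed by an additive (not necessarily commutative)
  monoid. With this instance, finitely supported functions on words form the free
  associative unital algebra.
\<close>

instantiation list :: (type) monoid_add
begin

definition zero_list :: "'a list" where "0 = []"

definition plus_list :: "'a list \<Rightarrow> 'a list \<Rightarrow> 'a list" where "xs + ys = xs @ ys"

instance by standard (simp_all add: zero_list_def plus_list_def)

end

type_synonym ('a, 'k) free_alg = "'a list \<Rightarrow>\<^sub>0 'k"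

definition const :: "'k::ring_1 \<Rightarrow> ('a, 'k) free_alg" where
  "const c = Poly_Mapping.single [] c"

definition var :: "'a \<Rightarrow> ('a, 'k::ring_1) free_alg" where
  "var a = Poly_Mapping.single [a] 1"

definition max_degree :: "('a, 'k::zero) free_alg \<Rightarrow> nat" where
  "max_degree f = Max (length ` Poly_Mapping.keys f)"

lift_definition hom_component :: "nat \<Rightarrow> ('a, 'k::zero) free_alg \<Rightarrow> ('a, 'k) free_alg"
  is "\<lambda>n f w. if length w = n then f w else 0"
  by (rule finite_subset[rotated]) auto

definition centralizer :: "'r::semigroup_mult \<Rightarrow> 'r set" where
  "centralizer g = {f. f * g = g * f}"

definition unital_subalgebra :: "('a, 'k::ring_1) free_alg set \<Rightarrow> bool" where
  "unital_subalgebra A \<longleftrightarrow>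
     (\<forall>c. const c \<in> A) \<and> (\<forall>f\<in>A. \<forall>h\<in>A. f + h \<in> A) \<and> (\<forall>f\<in>A. \<forall>h\<in>A. f * h \<in> A)"

definition generated_subalgebra :: "('a, 'k::ring_1) free_alg \<Rightarrow> ('a, 'k) free_alg set" where
  "generated_subalgebra g = unital_subalgebra hull {g}"

definition generates_centralizer :: "('a, 'k::ring_1) free_alg \<Rightarrow> bool" where
  "generates_centralizer g \<longleftrightarrow> centralizer g = generated_subalgebra g"


section \<open>The free group\<close>

text \<open>
  The letter \<^term>\<open>(a, True)\<close> stands for the generator \<open>a\<close>, and \<^term>\<open>(a, False)\<close> for its
  inverse. Elements of the free group are the reduced words.
\<close>

type_synonym 'a letter = "'a \<times> bool"

definition inv_letter :: "'a letter \<Rightarrow> 'a letter" where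
  "inv_letter l = (fst l, \<not> snd l)"

definition reduced :: "'a letter list \<Rightarrow> bool" where
  "reduced w \<longleftrightarrow> (\<forall>i. Suc i < length w \<longrightarrow> w ! Suc i \<noteq> inv_letter (w ! i))"

fun push :: "'a letter \<Rightarrow> 'a letter list \<Rightarrow> 'a letter list" where
  "push l [] = [l]"
| "push l (m # w) = (if m = inv_letter l then w else l # m # w)"

lemma inv_letter_inv_letter [simp]: "inv_letter (inv_letter l) = l"
  by (simp add: inv_letter_def)

lemma inv_letter_neq [simp]: "inv_letter l \<noteq> l" "l \<noteq> inv_letter l"
  by (auto simp: inv_letter_def prod_eq_iff)

lemma reduced_Nil [simp]: "reduced []"
  by (simp add: reduced_def)

lemma reduced_Cons:
  "reduced (l # w) \<longleftrightarrow> reduced w \<and> (w = [] \<or> hd w \<noteq> inv_letter l)"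
proof (cases w)
  case Nil
  then show ?thesis by (simp add: reduced_def)
next
  case (Cons m v)
  show ?thesis
    unfolding reduced_def Cons
    by (auto simp: nth_Cons split: nat.splits)
qed

lemma reduced_push: "reduced w \<Longrightarrow> reduced (push l w)"
  by (cases w) (auto simp: reduced_Cons)

lemma reduced_foldr_push: "reduced w \<Longrightarrow> reduced (foldr push v w)"
  by (induction v) (auto intro: reduced_push)

lemma push_push_inv: "reduced w \<Longrightarrow> push l (push (inv_letter l) w) = w"
proof (cases w)
  case (Cons m v)
  assume "reduced w"
  then show ?thesis using Cons by (cases v) (auto simp: reduced_Cons)
qed simp

lemma foldr_push_push:
  "reduced z \<Longrightarrow> foldr push (push l w) z = push l (foldr push w z)"
  by (cases w) (auto simp: push_push_inv reduced_foldr_push)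

lemma foldr_push_foldr_push:
  "reduced z \<Longrightarrow> foldr push (foldr push u v) z = foldr push u (foldr push v z)"
  by (induction u) (auto simp: foldr_push_push)

lemma foldr_push_reduced: "reduced w \<Longrightarrow> foldr push w [] = w"
proof (induction w)
  case (Cons l w)
  then show ?case by (cases w) (auto simp: reduced_Cons)
qed simp

lemma foldr_push_inverse:
  "reduced z \<Longrightarrow> foldr push (rev (map inv_letter w)) (foldr push w z) = z"
proof (induction w arbitrary: z)
  case (Cons l w)
  have "push (inv_letter l) (push l (foldr push w z)) = foldr push w z"
    using push_push_inv[of "foldr push w z" "inv_letter l"] Cons.prems
    by (simp add: reduced_foldr_push)
  then show ?case using Cons by simp
qed simp

lemma reduced_inverse:
  assumes "reduced w" shows "reduced (rev (map inv_letter w))"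
  unfolding reduced_def
proof (intro allI impI)
  fix i assume i: "Suc i < length (rev (map inv_letter w))"
  define j where "j = length w - Suc (Suc i)"
  have j: "Suc j < length w" "length w - Suc i = Suc j"
    using i by (auto simp: j_def)
  have "w ! Suc j \<noteq> inv_letter (w ! j)"
    using assms j by (auto simp: reduced_def)
  then show "rev (map inv_letter w) ! Suc i \<noteq> inv_letter (rev (map inv_letter w) ! i)"
    using i j by (auto simp: rev_nth j_def)
qed

typedef 'a free_group = "{w :: 'a letter list. reduced w}"
  morphisms reduced_word Abs_free_group
  by (rule exI[of _ "[]"]) simp

setup_lifting type_definition_free_group

text \<open>The group operation of the free group is written additively as well.\<close>

instantiation free_group :: (type) group_add
begin

lift_definition zero_free_group :: "'a free_group" is "[]" by simp

lift_definition plus_free_group :: "'a free_group \<Rightarrow> 'a free_group \<Rightarrow> 'a free_group"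
  is "\<lambda>u v. foldr push u v" by (rule reduced_foldr_push)

lift_definition uminus_free_group :: "'a free_group \<Rightarrow> 'a free_group"
  is "\<lambda>w. rev (map inv_letter w)" by (rule reduced_inverse)

definition minus_free_group :: "'a free_group \<Rightarrow> 'a free_group \<Rightarrow> 'a free_group" where
  "u - v = u + - (v :: 'a free_group)"

instance
proof
  fix a b c :: "'a free_group"
  show "a + b + c = a + (b + c)"
    by transfer (simp add: foldr_push_foldr_push)
  show "0 + a = a" by transfer simp
  show "a + 0 = a" by transfer (simp add: foldr_push_reduced)
  show "- a + a = 0"
  proof transfer
    fix w :: "'a letter list" assume "reduced w"
    then show "foldr push (rev (map inv_letter w)) w = []"
      using foldr_push_inverse[of "[]" w] by (simp add: foldr_push_reduced)
  qed
  show "a + - b = a - b" by (simp add: minus_free_group_def)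
qed

end

definition deg :: "'a free_group \<Rightarrow> int" where
  "deg z = (\<Sum>l\<leftarrow>reduced_word z. if snd l then 1 else - 1)"

lemma deg_add: "deg (a + b) = deg a + deg b"
proof -
  let ?d = "\<lambda>w :: 'a letter list. \<Sum>l\<leftarrow>w. (if snd l then 1 else - 1 :: int)"
  have push: "?d (push l w) = (if snd l then 1 else - 1) + ?d w" for l :: "'a letter" and w
    by (cases w) (auto simp: inv_letter_def)
  have "?d (foldr push u v) = ?d u + ?d v" for u v :: "'a letter list"
    by (induction u) (simp_all add: push)
  then show ?thesis by (simp add: deg_def plus_free_group.rep_eq)
qed

definition has_negative_power :: "'a free_group \<Rightarrow> bool" where
  "has_negative_power z \<longleftrightarrow> (\<exists>a. (a, False) \<in> set (reduced_word z))"

lift_definition of_word :: "'a list \<Rightarrow> 'a free_group" is "map (\<lambda>a. (a, True))"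
  by (auto simp: reduced_def inv_letter_def)

lemma of_word_add: "of_word (v + w) = of_word v + of_word w"
proof transfer
  fix v w :: "'a list"
  have push: "push (a, True) (map (\<lambda>a. (a, True)) u) = (a, True) # map (\<lambda>a. (a, True)) u"
    for a and u :: "'a list"
    by (cases u) (auto simp: inv_letter_def)
  have "foldr push (map (\<lambda>a. (a, True)) v) (map (\<lambda>a. (a, True)) w)
      = map (\<lambda>a. (a, True)) (v @ w)"
    by (induction v) (simp_all add: push flip: map_append)
  then show "map (\<lambda>a. (a, True)) (v + w)
      = foldr push (map (\<lambda>a. (a, True)) v) (map (\<lambda>a. (a, True)) w)"
    by (simp add: plus_list_def)
qed


section \<open>The Malcev--Neumann algebra\<close>

text \<open>\<^term>\<open>(a, b) \<in> r\<close> means that \<open>a\<close> is at most \<open>b\<close>.\<close>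

definition graded_group_order :: "'a free_group rel \<Rightarrow> bool" where
  "graded_group_order r \<longleftrightarrow>
     linear_order r \<and>
     (\<forall>a b c. (a, b) \<in> r \<longrightarrow> (c + a, c + b) \<in> r \<and> (a + c, b + c) \<in> r) \<and>
     (\<forall>a b. deg a < deg b \<longrightarrow> (a, b) \<in> r)"

definition opposite_well_ordered :: "'g rel \<Rightarrow> 'g set \<Rightarrow> bool" where
  "opposite_well_ordered r D \<longleftrightarrow> (\<forall>S\<subseteq>D. S \<noteq> {} \<longrightarrow> (\<exists>m\<in>S. \<forall>z\<in>S. (z, m) \<in> r))"

text \<open>A formal sum is represented by its coefficient function.\<close>

definition series_mult :: "('g::group_add \<Rightarrow> 'k::semiring_0) \<Rightarrow> ('g \<Rightarrow> 'k) \<Rightarrow> 'g \<Rightarrow> 'k" where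
  "series_mult \<sigma> \<tau> z = (\<Sum>(a, b) \<in> {(a, b). \<sigma> a \<noteq> 0 \<and> \<tau> b \<noteq> 0 \<and> a + b = z}. \<sigma> a * \<tau> b)"

definition malcev_neumann :: "'a free_group rel \<Rightarrow> ('a free_group \<Rightarrow> 'k::field) ring" where
  "malcev_neumann r =
     \<lparr>carrier = {\<tau>. opposite_well_ordered r {z. \<tau> z \<noteq> 0}},
      mult = series_mult,
      one = (\<lambda>z. if z = 0 then 1 else 0),
      zero = (\<lambda>z. 0),
      add = (\<lambda>\<sigma> \<tau> z. \<sigma> z + \<tau> z)\<rparr>"

definition to_series :: "('a, 'k::field) free_alg \<Rightarrow> 'a free_group \<Rightarrow> 'k" where
  "to_series f z = (\<Sum>w \<in> {w \<in> Poly_Mapping.keys f. of_word w = z}. Poly_Mapping.lookup f w)"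

text \<open>
  The sum defining \<^const>\<open>series_mult\<close> is finite for elements of the Malcev--Neumann algebra,
  so the convention that infinite sums are zero plays no role there.
\<close>

lemma finite_if_max_min:
  assumes r: "linear_order r"
    and max: "\<And>S. S \<subseteq> P \<Longrightarrow> S \<noteq> {} \<Longrightarrow> \<exists>m\<in>S. \<forall>z\<in>S. (z, m) \<in> r"
    and min: "\<And>S. S \<subseteq> P \<Longrightarrow> S \<noteq> {} \<Longrightarrow> \<exists>m\<in>S. \<forall>z\<in>S. (m, z) \<in> r"
  shows "finite P"
proof -
  define L where "L a = {b \<in> P. (b, a) \<in> r}" for a
  have antisym: "x = y" if "(x, y) \<in> r" "(y, x) \<in> r" for x y
    using r that by (auto simp: order_on_defs antisym_def)
  have trans: "(x, z) \<in> r" if "(x, y) \<in> r" "(y, z) \<in> r" for x y z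
    using r that by (auto simp: order_on_defs trans_def)
  have total: "(x, y) \<in> r \<or> (y, x) \<in> r" for x y
    using r by (cases "x = y") (auto simp: order_on_defs total_on_def refl_on_def)
  have fin: "finite (L a)" if "a \<in> P" for a
  proof (rule ccontr)
    assume "infinite (L a)"
    then have "{a \<in> P. infinite (L a)} \<noteq> {}" using that by auto
    then obtain m where m: "m \<in> P" "infinite (L m)"
        and m_min: "\<And>z. z \<in> P \<Longrightarrow> infinite (L z) \<Longrightarrow> (m, z) \<in> r"
      using min[of "{a \<in> P. infinite (L a)}"] by auto
    have "infinite (L m - {m})" using m by simp
    then have ne: "L m - {m} \<noteq> {}" by (metis finite.emptyI)
    obtain q where q: "q \<in> L m - {m}" and q_max: "\<And>z. z \<in> L m - {m} \<Longrightarrow> (z, q) \<in> r"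
      using max[OF _ ne] by (auto simp: L_def)
    have "finite (L q)"
      using q m_min[of q] antisym[of q m] by (auto simp: L_def)
    moreover have "L m - {m} \<subseteq> L q"
      using q_max by (auto simp: L_def)
    ultimately show False
      using \<open>infinite (L m - {m})\<close> finite_subset by blast
  qed
  show ?thesis
  proof (cases "P = {}")
    case False
    then obtain m where "m \<in> P" "\<forall>z\<in>P. (z, m) \<in> r" using max[of P] by auto
    then have "P = L m" by (auto simp: L_def)
    then show ?thesis using fin[OF \<open>m \<in> P\<close>] by simp
  qed simp
qed

lemma finite_series_mult:
  assumes r: "graded_group_order r"
    and \<sigma>: "\<sigma> \<in> carrier (malcev_neumann r)" and \<tau>: "\<tau> \<in> carrier (malcev_neumann r)"
  shows "finite {(a, b). \<sigma> a \<noteq> 0 \<and> \<tau> b \<noteq> 0 \<and> a + b = z}"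
proof -
  define P where "P = {a. \<sigma> a \<noteq> 0 \<and> \<tau> (- a + z) \<noteq> 0}"
  have left: "(c + a, c + b) \<in> r" and right: "(a + c, b + c) \<in> r" if "(a, b) \<in> r" for a b c
    using r that unfolding graded_group_order_def by blast+
  have "finite P"
  proof (rule finite_if_max_min)
    show "linear_order r" using r by (simp add: graded_group_order_def)
  next
    fix S assume S: "S \<subseteq> P" "S \<noteq> {}"
    have "S \<subseteq> {z. \<sigma> z \<noteq> 0}" using S by (auto simp: P_def)
    then show "\<exists>m\<in>S. \<forall>z\<in>S. (z, m) \<in> r"
      using \<sigma> S unfolding malcev_neumann_def opposite_well_ordered_def by simp
  next
    fix S assume S: "S \<subseteq> P" "S \<noteq> {}"
    have "(\<lambda>a. - a + z) ` S \<subseteq> {z. \<tau> z \<noteq> 0}" "(\<lambda>a. - a + z) ` S \<noteq> {}"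
      using S by (auto simp: P_def)
    then have "\<exists>m\<in>(\<lambda>a. - a + z) ` S. \<forall>x\<in>(\<lambda>a. - a + z) ` S. (x, m) \<in> r"
      using \<tau> unfolding malcev_neumann_def opposite_well_ordered_def
      by (simp del: image_is_empty bex_simps ball_simps)
    then obtain m where m: "m \<in> S" "\<And>a. a \<in> S \<Longrightarrow> (- a + z, - m + z) \<in> r" by auto
    have "(m, a) \<in> r" if "a \<in> S" for a
    proof -
      have "(a + ((- a + z) + - z) + m, a + ((- m + z) + - z) + m) \<in> r"
        by (intro left right m that)
      then show ?thesis by (simp add: add.assoc)
    qed
    then show "\<exists>m\<in>S. \<forall>z\<in>S. (m, z) \<in> r" using m by blast
  qed
  moreover have "{(a, b). \<sigma> a \<noteq> 0 \<and> \<tau> b \<noteq> 0 \<and> a + b = z} \<subseteq> (\<lambda>a. (a, - a + z)) ` P"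
    by (auto simp: P_def image_iff simp flip: add.assoc)
  ultimately show ?thesis by (rule finite_surj)
qed


section \<open>Two generators\<close>

datatype gen = GX | GY

end

theory Submission
  imports Defs
begin

text \<open>
  Write \<open>n = 2k + 1\<close> for the degree of \<open>u\<close>, so that \<open>g = u\<^sup>2 + xy + yx\<close>.

  \<^emph>\<open>Centralizer.\<close> Give \<open>x\<close> the weight \<open>2k - 1\<close> and \<open>y\<close> the weight \<open>-(2k + 1)\<close>. Then \<open>u\<close> has weight
  \<open>-1\<close> and all three words of \<open>g\<close> have weight \<open>-2\<close>, so the weight components of an element of
  \<open>C(g)\<close> lie in \<open>C(g)\<close> again and it suffices to treat a homogeneous \<open>f\<close>. In a free algebra over
  a domain leading words multiply; hence the leading word of \<open>f\<close> for the degree-lexicographic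
  order commutes with the leading word \<open>u\<^sup>2\<close> of \<open>g\<close>. As \<open>u\<close> is not a proper power, the leading
  word is a power of \<open>u\<close> (\<open>commutes_with_uword_square\<close>), and since its weight is that of \<open>f\<close>, the
  exponent is determined: each weight contributes at most one dimension to \<open>C(g)\<close>. In weight
  \<open>-2m\<close> this dimension is spanned by \<open>g\<^sup>m\<close> (\<open>centralizer_component_even\<close>). In an odd weight \<open>-m\<close>
  there is nothing (\<open>centralizer_component_odd\<close>): \<open>f\<^sup>2\<close> would be a nonzero multiple of \<open>g\<^sup>m\<close>, and
  comparing the least words instead of the greatest ones, some word \<open>p\<close> would satisfy
  \<open>p p = (xy)\<^sup>m\<close>, whereas \<open>x\<close> occurs an odd number of times on the right.

  \<^emph>\<open>Square root.\<close> Because \<open>(xy) u = u (yx)\<close>, the element \<open>t = u\<^sup>-\<^sup>1 (xy) = (yx) u\<^sup>-\<^sup>1\<close> of the free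
  group satisfies \<open>u t + t u = xy + yx\<close>. So a square root \<open>\<rho>\<close> of \<open>g\<close> starts with
  \<open>c u + c t\<close>, where \<open>c\<^sup>2 = 1\<close>. The rest of \<open>\<rho>\<close> has to compensate \<open>t\<^sup>2\<close>, of degree \<open>4 - 2n\<close>, by its
  products with \<open>u\<close>, which forces its degree to be at most \<open>4 - 3n\<close>, below \<open>-2n\<close>; this is
  \<open>square_root_support\<close>. Therefore only \<open>u\<^sup>3\<close>, \<open>u\<^sup>2 t = u (xy)\<close>, \<open>(xy) u\<close> and \<open>(yx) u\<close> can
  occur in positive degree in \<open>\<rho>\<^sup>3 = g \<rho>\<close>, and these are words in \<open>x\<close> and \<open>y\<close>.
\<close>


section \<open>Products and leading words in the free algebra\<close>

lemma lookup_times: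
  fixes f h :: "('a, 'k::idom) free_alg"
  assumes "finite A" "Poly_Mapping.keys f \<subseteq> A" "finite B" "Poly_Mapping.keys h \<subseteq> B"
  shows "Poly_Mapping.lookup (f * h) z =
    (\<Sum>p\<in>A. \<Sum>q\<in>B. if p + q = z then Poly_Mapping.lookup f p * Poly_Mapping.lookup h q else 0)"
proof -
  have decomp: "e = (\<Sum>p\<in>C. Poly_Mapping.single p (Poly_Mapping.lookup e p))"
    if "finite C" "Poly_Mapping.keys e \<subseteq> C" for e :: "('a, 'k) free_alg" and C
    by (rule poly_mapping_eqI)
      (use that in \<open>auto simp: lookup_sum lookup_single when_def in_keys_iff\<close>)
  have "f * h = (\<Sum>p\<in>A. \<Sum>q\<in>B.
      Poly_Mapping.single (p + q) (Poly_Mapping.lookup f p * Poly_Mapping.lookup h q))"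
    by (subst decomp[OF assms(1,2)], subst decomp[OF assms(3,4)])
      (simp add: sum_product mult_single)
  then show ?thesis
    by (simp add: lookup_sum lookup_single when_def)
qed

text \<open>
  Words are compared through an injective integer rank. The reversed order is then given by the
  negated rank, so that one set of lemmas treats greatest and least words alike.
\<close>

definition word_order :: "('a list \<Rightarrow> int) \<Rightarrow> bool" where
  "word_order \<kappa> \<longleftrightarrow> inj \<kappa> \<and>
     (\<forall>p p' q. \<kappa> p < \<kappa> p' \<longrightarrow> \<kappa> (p + q) < \<kappa> (p' + q) \<and> \<kappa> (q + p) < \<kappa> (q + p'))"

definition leading :: "('a list \<Rightarrow> int) \<Rightarrow> ('a, 'k::zero) free_alg \<Rightarrow> 'a list \<Rightarrow> bool" where
  "leading \<kappa> f p \<longleftrightarrow> p \<in> Poly_Mapping.keys f \<and> (\<forall>q\<in>Poly_Mapping.keys f. \<kappa> q \<le> \<kappa> p)"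

lemma leading_exists:
  assumes "f \<noteq> 0"
  shows "\<exists>p. leading \<kappa> f p"
proof -
  have "finite (\<kappa> ` Poly_Mapping.keys f)" "\<kappa> ` Poly_Mapping.keys f \<noteq> {}"
    using assms by auto
  then have "Max (\<kappa> ` Poly_Mapping.keys f) \<in> \<kappa> ` Poly_Mapping.keys f"
    "\<forall>q\<in>Poly_Mapping.keys f. \<kappa> q \<le> Max (\<kappa> ` Poly_Mapping.keys f)"
    by simp_all
  then show ?thesis unfolding leading_def by force
qed

lemma leading_unique:
  assumes "word_order \<kappa>" "leading \<kappa> f p" "leading \<kappa> f q"
  shows "p = q"
  using assms by (meson leading_def word_order_def injD antisym)

text \<open>
  The equality case is what makes leading coefficients multiply: the product of the leading words
  arises from no other pair of words.
\<close>

lemma word_order_mono: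
  assumes "word_order \<kappa>" "\<kappa> p \<le> \<kappa> p'" "\<kappa> q \<le> \<kappa> q'"
  shows "\<kappa> (p + q) \<le> \<kappa> (p' + q')"
    and "p + q = p' + q' \<Longrightarrow> p = p' \<and> q = q'"
proof -
  have L: "\<kappa> (p + q) < \<kappa> (p' + q)" if "\<kappa> p < \<kappa> p'" for p p' q
    using assms(1) that by (auto simp: word_order_def)
  have R: "\<kappa> (q + p) < \<kappa> (q + p')" if "\<kappa> p < \<kappa> p'" for p p' q
    using assms(1) that by (auto simp: word_order_def)
  have inj: "a = b" if "\<kappa> a = \<kappa> b" for a b
    using assms(1) that by (auto simp: word_order_def inj_def)
  consider "\<kappa> p < \<kappa> p'" | "p = p'" "\<kappa> q < \<kappa> q'" | "p = p'" "q = q'"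
    using assms(2,3) inj by force
  then have "\<kappa> (p + q) < \<kappa> (p' + q') \<or> p = p' \<and> q = q'"
  proof cases
    case 1
    then have "\<kappa> (p + q) < \<kappa> (p' + q)" by (rule L)
    also have "\<kappa> (p' + q) \<le> \<kappa> (p' + q')"
      using assms(3) R[of q q' p'] inj[of q q'] by (cases "\<kappa> q = \<kappa> q'") auto
    finally show ?thesis ..
  qed (use R in auto)
  then show "\<kappa> (p + q) \<le> \<kappa> (p' + q')" "p + q = p' + q' \<Longrightarrow> p = p' \<and> q = q'"
    by auto
qed

lemma leading_times:
  fixes f h :: "('a, 'k::idom) free_alg"
  assumes \<kappa>: "word_order \<kappa>" and f: "leading \<kappa> f p" and h: "leading \<kappa> h q"
  shows "leading \<kappa> (f * h) (p + q)"
    and "Poly_Mapping.lookup (f * h) (p + q) = Poly_Mapping.lookup f p * Poly_Mapping.lookup h q"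
proof -
  have pq: "p \<in> Poly_Mapping.keys f" "q \<in> Poly_Mapping.keys h"
    using f h by (auto simp: leading_def)
  have "Poly_Mapping.lookup (f * h) (p + q) = (\<Sum>p'\<in>Poly_Mapping.keys f. \<Sum>q'\<in>Poly_Mapping.keys h.
      if p' + q' = p + q then Poly_Mapping.lookup f p' * Poly_Mapping.lookup h q' else 0)"
    by (rule lookup_times) simp_all
  also have "\<dots> = (\<Sum>p'\<in>Poly_Mapping.keys f. \<Sum>q'\<in>Poly_Mapping.keys h.
      if q' = q then if p' = p then Poly_Mapping.lookup f p * Poly_Mapping.lookup h q else 0 else 0)"
    using f h word_order_mono(2)[OF \<kappa>]
    by (intro sum.cong refl) (auto simp: leading_def)
  also have "\<dots> = Poly_Mapping.lookup f p * Poly_Mapping.lookup h q"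
    using pq by (simp add: sum.delta)
  finally show eq: "Poly_Mapping.lookup (f * h) (p + q) =
      Poly_Mapping.lookup f p * Poly_Mapping.lookup h q" .
  have "\<kappa> z \<le> \<kappa> (p + q)" if z: "z \<in> Poly_Mapping.keys (f * h)" for z
  proof -
    obtain p' q' where "z = p' + q'" "p' \<in> Poly_Mapping.keys f" "q' \<in> Poly_Mapping.keys h"
      using z keys_mult[of f h] by blast
    then show ?thesis
      using f h by (auto simp: leading_def intro!: word_order_mono(1)[OF \<kappa>])
  qed
  then show "leading \<kappa> (f * h) (p + q)"
    using eq pq by (auto simp: leading_def in_keys_iff)
qed

lemma leading_power:
  fixes f :: "('a, 'k::idom) free_alg"
  assumes \<kappa>: "word_order \<kappa>" and f: "leading \<kappa> f p"
  shows "leading \<kappa> (f ^ n) (concat (replicate n p))"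
    and "Poly_Mapping.lookup (f ^ n) (concat (replicate n p)) = Poly_Mapping.lookup f p ^ n"
proof -
  have "leading \<kappa> (f ^ n) (concat (replicate n p)) \<and>
    Poly_Mapping.lookup (f ^ n) (concat (replicate n p)) = Poly_Mapping.lookup f p ^ n"
  proof (induction n)
    case 0
    show ?case
      by (simp add: leading_def lookup_one zero_list_def when_def)
  next
    case (Suc n)
    then show ?case
      using leading_times[OF \<kappa> f, of "f ^ n" "concat (replicate n p)"]
      by (simp add: plus_list_def)
  qed
  then show "leading \<kappa> (f ^ n) (concat (replicate n p))"
    and "Poly_Mapping.lookup (f ^ n) (concat (replicate n p)) = Poly_Mapping.lookup f p ^ n"
    by auto
qed

lemma leading_commute:
  fixes f h :: "('a, 'k::idom) free_alg"
  assumes "word_order \<kappa>" "leading \<kappa> f p" "leading \<kappa> h q" "f * h = h * f"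
  shows "p @ q = q @ p"
  using leading_unique[OF assms(1), of "f * h" "p + q" "q + p"]
    leading_times(1)[OF assms(1,2,3)] leading_times(1)[OF assms(1,3,2)] assms(4)
  by (simp add: plus_list_def)


section \<open>The degree-lexicographic order\<close>

text \<open>
  Reading a word as a number in bijective base two (digits 1 and 2) compares words first by
  length and then lexicographically.
\<close>

fun deglex_rank :: "gen list \<Rightarrow> nat" where
  "deglex_rank [] = 0"
| "deglex_rank (a # w) = (case a of GX \<Rightarrow> 1 | GY \<Rightarrow> 2) * 2 ^ length w + deglex_rank w"

lemma deglex_rank_append:
  "deglex_rank (p @ q) = deglex_rank p * 2 ^ length q + deglex_rank q"
  by (induction p) (auto simp: algebra_simps power_add)

lemma deglex_rank_bounds:
  "2 ^ length w \<le> deglex_rank w + 1" "deglex_rank w + 2 \<le> 2 * 2 ^ length w"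
  by (induction w) (auto split: gen.splits)

lemma inj_deglex_rank: "inj deglex_rank"
proof
  show "p = q" if "deglex_rank p = deglex_rank q" for p q
    using that
  proof (induction p arbitrary: q rule: rev_induct)
    case Nil
    then show ?case by (cases q) (auto split: gen.splits)
  next
    case (snoc a p)
    show ?case
    proof (cases q rule: rev_cases)
      case Nil
      then show ?thesis
        using snoc.prems by (cases a) (auto simp: deglex_rank_append)
    next
      case q: (snoc q' b)
      have "2 * deglex_rank p + (case a of GX \<Rightarrow> 1 | GY \<Rightarrow> 2) =
          2 * deglex_rank q' + (case b of GX \<Rightarrow> 1 | GY \<Rightarrow> 2)"
        using snoc.prems q by (simp add: deglex_rank_append)
      then have "a = b \<and> deglex_rank p = deglex_rank q'"
        by (auto split: gen.splits) presburger+
      then show ?thesis using snoc.IH q by simp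
    qed
  qed
qed

lemma length_le_if_deglex_rank_less:
  assumes "deglex_rank p < deglex_rank q"
  shows "length p \<le> length q"
proof (rule ccontr)
  assume "\<not> length p \<le> length q"
  then have "Suc (length q) \<le> length p" by simp
  then have "(2::nat) ^ Suc (length q) \<le> 2 ^ length p"
    by (rule power_increasing) simp
  then show False
    using deglex_rank_bounds(2)[of q] deglex_rank_bounds(1)[of p] assms by simp
qed

lemma deglex_rank_mono:
  assumes "deglex_rank p < deglex_rank p'"
  shows "deglex_rank (p @ q) < deglex_rank (p' @ q)"
    and "deglex_rank (q @ p) < deglex_rank (q @ p')"
proof -
  show "deglex_rank (p @ q) < deglex_rank (p' @ q)"
    using assms by (simp add: deglex_rank_append)
  have "(2::nat) ^ length p \<le> 2 ^ length p'"
    using length_le_if_deglex_rank_less[OF assms] by simp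
  then have "deglex_rank q * 2 ^ length p \<le> deglex_rank q * 2 ^ length p'"
    by (rule mult_le_mono2)
  then show "deglex_rank (q @ p) < deglex_rank (q @ p')"
    unfolding deglex_rank_append using assms by linarith
qed

lemma word_order_deglex:
  "word_order (\<lambda>w. int (deglex_rank w))" "word_order (\<lambda>w. - int (deglex_rank w))"
  using inj_deglex_rank by (auto simp: word_order_def inj_def plus_list_def deglex_rank_mono)


section \<open>Weight gradings\<close>

definition homogeneous :: "('a list \<Rightarrow> int) \<Rightarrow> int \<Rightarrow> ('a, 'k::zero) free_alg \<Rightarrow> bool" where
  "homogeneous \<omega> d f \<longleftrightarrow> (\<forall>w\<in>Poly_Mapping.keys f. \<omega> w = d)"

lift_definition weight_component ::
    "('a list \<Rightarrow> int) \<Rightarrow> int \<Rightarrow> ('a, 'k::zero) free_alg \<Rightarrow> ('a, 'k) free_alg"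
  is "\<lambda>\<omega> d f w. if \<omega> w = d then f w else 0"
  by (rule finite_subset[rotated]) auto

lemma homogeneous_weight_component: "homogeneous \<omega> d (weight_component \<omega> d f)"
  by (auto simp: homogeneous_def in_keys_iff weight_component.rep_eq split: if_splits)

lemma keys_weight_component: "Poly_Mapping.keys (weight_component \<omega> d f) \<subseteq> Poly_Mapping.keys f"
  by (auto simp: in_keys_iff weight_component.rep_eq split: if_splits)

lemma weight_component_times:
  fixes f h :: "('a, 'k::idom) free_alg"
  assumes \<omega>: "\<And>p q. \<omega> (p @ q) = \<omega> p + \<omega> q" and h: "homogeneous \<omega> d h"
  shows "weight_component \<omega> c f * h = weight_component \<omega> (c + d) (f * h)"
    and "h * weight_component \<omega> c f = weight_component \<omega> (c + d) (h * f)"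
proof -
  let ?F = "Poly_Mapping.keys f" and ?H = "Poly_Mapping.keys h"
  let ?l = "Poly_Mapping.lookup"
  show "weight_component \<omega> c f * h = weight_component \<omega> (c + d) (f * h)"
  proof (rule poly_mapping_eqI)
    fix z
    have "?l (weight_component \<omega> c f * h) z = (\<Sum>p\<in>?F. \<Sum>q\<in>?H. if p + q = z
        then ?l (weight_component \<omega> c f) p * ?l h q else 0)"
      by (rule lookup_times) (simp_all add: keys_weight_component)
    also have "\<dots> = (\<Sum>p\<in>?F. \<Sum>q\<in>?H. if \<omega> z = c + d
        then if p + q = z then ?l f p * ?l h q else 0 else 0)"
      using h by (intro sum.cong refl)
        (auto simp: weight_component.rep_eq homogeneous_def plus_list_def \<omega>)
    also have "\<dots> = ?l (weight_component \<omega> (c + d) (f * h)) z"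
      by (simp add: weight_component.rep_eq lookup_times[of ?F _ ?H])
    finally show "?l (weight_component \<omega> c f * h) z = ?l (weight_component \<omega> (c + d) (f * h)) z" .
  qed
  show "h * weight_component \<omega> c f = weight_component \<omega> (c + d) (h * f)"
  proof (rule poly_mapping_eqI)
    fix z
    have "?l (h * weight_component \<omega> c f) z = (\<Sum>p\<in>?H. \<Sum>q\<in>?F. if p + q = z
        then ?l h p * ?l (weight_component \<omega> c f) q else 0)"
      by (rule lookup_times) (simp_all add: keys_weight_component)
    also have "\<dots> = (\<Sum>p\<in>?H. \<Sum>q\<in>?F. if \<omega> z = c + d
        then if p + q = z then ?l h p * ?l f q else 0 else 0)"
      using h by (intro sum.cong refl)
        (auto simp: weight_component.rep_eq homogeneous_def plus_list_def \<omega>)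
    also have "\<dots> = ?l (weight_component \<omega> (c + d) (h * f)) z"
      by (simp add: weight_component.rep_eq lookup_times[of ?H _ ?F])
    finally show "?l (h * weight_component \<omega> c f) z = ?l (weight_component \<omega> (c + d) (h * f)) z" .
  qed
qed

text \<open>
  Multiplication by a homogeneous element shifts weights uniformly, on either side, so the
  commutation equation splits into its components.
\<close>

lemma weight_component_in_centralizer:
  fixes f h :: "('a, 'k::idom) free_alg"
  assumes "\<And>p q. \<omega> (p @ q) = \<omega> p + \<omega> q" and "homogeneous \<omega> d h" and "f \<in> centralizer h"
  shows "weight_component \<omega> c f \<in> centralizer h"
  using weight_component_times[OF assms(1,2), of c f] assms(3) by (simp add: centralizer_def)

lemma sum_weight_components:
  fixes f :: "('a, 'k::idom) free_alg"
  shows "(\<Sum>c\<in>\<omega> ` Poly_Mapping.keys f. weight_component \<omega> c f) = f"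
  by (rule poly_mapping_eqI) (auto simp: lookup_sum weight_component.rep_eq in_keys_iff)

lemma homogeneous_times:
  fixes f h :: "('a, 'k::idom) free_alg"
  assumes "\<And>p q. \<omega> (p @ q) = \<omega> p + \<omega> q" "homogeneous \<omega> c f" "homogeneous \<omega> d h"
  shows "homogeneous \<omega> (c + d) (f * h)"
  unfolding homogeneous_def
proof
  fix z assume z: "z \<in> Poly_Mapping.keys (f * h)"
  obtain p q where "z = p + q" "p \<in> Poly_Mapping.keys f" "q \<in> Poly_Mapping.keys h"
    using z keys_mult[of f h] by blast
  then show "\<omega> z = c + d"
    using assms by (simp add: homogeneous_def plus_list_def)
qed

lemma homogeneous_power:
  fixes f :: "('a, 'k::idom) free_alg"
  assumes "\<And>p q. \<omega> (p @ q) = \<omega> p + \<omega> q" "homogeneous \<omega> c f"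
  shows "homogeneous \<omega> (int n * c) (f ^ n)"
proof (induction n)
  case 0
  have "\<omega> [] = 0" using assms(1)[of "[]" "[]"] by simp
  then show ?case by (simp add: homogeneous_def zero_list_def)
next
  case (Suc n)
  have "homogeneous \<omega> (c + int n * c) (f * f ^ n)"
    by (intro homogeneous_times assms Suc)
  then show ?case by (simp add: algebra_simps)
qed

lemma homogeneous_diff:
  fixes f h :: "('a, 'k::idom) free_alg"
  assumes "homogeneous \<omega> c f" "homogeneous \<omega> c h"
  shows "homogeneous \<omega> c (f - h)"
  using assms by (auto simp: homogeneous_def in_keys_iff lookup_minus)


section \<open>Scalars and subalgebras\<close>

lemma lookup_const_times:
  fixes f :: "('a, 'k::idom) free_alg"
  shows "Poly_Mapping.lookup (const c * f) w = c * Poly_Mapping.lookup f w"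
proof -
  have "Poly_Mapping.lookup (const c * f) w =
      (\<Sum>p\<in>{[]}. \<Sum>q\<in>Poly_Mapping.keys f. if p + q = w
        then Poly_Mapping.lookup (const c) p * Poly_Mapping.lookup f q else 0)"
    by (rule lookup_times) (auto simp: const_def split: if_splits)
  also have "\<dots> = c * Poly_Mapping.lookup f w"
    by (auto simp: const_def plus_list_def in_keys_iff)
  finally show ?thesis .
qed

lemma lookup_times_const:
  fixes f :: "('a, 'k::idom) free_alg"
  shows "Poly_Mapping.lookup (f * const c) w = c * Poly_Mapping.lookup f w"
proof -
  have "Poly_Mapping.lookup (f * const c) w =
      (\<Sum>p\<in>Poly_Mapping.keys f. \<Sum>q\<in>{[]}. if p + q = w
        then Poly_Mapping.lookup f p * Poly_Mapping.lookup (const c) q else 0)"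
    by (rule lookup_times) (auto simp: const_def split: if_splits)
  also have "\<dots> = c * Poly_Mapping.lookup f w"
    by (auto simp: const_def plus_list_def in_keys_iff)
  finally show ?thesis .
qed

lemma const_commute:
  fixes f :: "('a, 'k::idom) free_alg"
  shows "const c * f = f * const c"
  by (rule poly_mapping_eqI) (simp add: lookup_const_times lookup_times_const)

lemma homogeneous_const_times:
  fixes f :: "('a, 'k::idom) free_alg"
  assumes "homogeneous \<omega> d f"
  shows "homogeneous \<omega> d (const c * f)"
  using assms by (auto simp: homogeneous_def in_keys_iff lookup_const_times)

lemma unital_subalgebra_centralizer:
  fixes g :: "('a, 'k::idom) free_alg"
  shows "unital_subalgebra (centralizer g)"
proof -
  have "f * h * g = g * (f * h)" if "f * g = g * f" "h * g = g * h" for f h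
    by (metis that mult.assoc)
  then show ?thesis
    by (auto simp: unital_subalgebra_def centralizer_def const_commute algebra_simps)
qed

lemma unital_subalgebra_closed:
  fixes g :: "('a, 'k::idom) free_alg"
  assumes "unital_subalgebra A"
  shows "f \<in> A \<Longrightarrow> const c * f ^ n \<in> A"
    and "(\<And>i. i \<in> I \<Longrightarrow> F i \<in> A) \<Longrightarrow> sum F I \<in> A"
    and "f \<in> A \<Longrightarrow> h \<in> A \<Longrightarrow> f - h \<in> A"
proof -
  have const: "const c \<in> A" for c
    using assms by (auto simp: unital_subalgebra_def)
  have add: "f + h \<in> A" and mult: "f * h \<in> A" if "f \<in> A" "h \<in> A" for f h
    using assms that by (auto simp: unital_subalgebra_def)
  have one: "1 \<in> A" and zero: "0 \<in> A" and minus: "- 1 \<in> A"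
    using const[of 1] const[of 0] const[of "- 1"]
    by (simp_all add: const_def zero_list_def[symmetric] single_uminus)
  have pow: "f ^ n \<in> A" if "f \<in> A" for f and n
    by (induction n) (auto intro: one mult that)
  show "const c * f ^ n \<in> A" if "f \<in> A" for f
    by (intro mult const pow that)
  show "sum F I \<in> A" if "\<And>i. i \<in> I \<Longrightarrow> F i \<in> A" for F :: "'i \<Rightarrow> _" and I
    using that by (induction I rule: infinite_finite_induct) (auto intro: zero add)
  show "f - h \<in> A" if "f \<in> A" "h \<in> A" for f h
    using add[OF that(1) mult[OF minus that(2)]] by simp
qed


section \<open>The centralizer\<close>

definition uword :: "nat \<Rightarrow> gen list" where
  "uword k = concat (replicate k [GX, GY]) @ [GX]"

text \<open>
  The polynomial \<open>g\<close> of the theorem, written out as a sum of three words.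
\<close>

definition gpoly :: "nat \<Rightarrow> (gen, 'k::idom) free_alg" where
  "gpoly k = Poly_Mapping.single (uword k @ uword k) 1 +
     Poly_Mapping.single [GX, GY] 1 + Poly_Mapping.single [GY, GX] 1"

lemma count_list_concat_replicate:
  "count_list (concat (replicate n w)) a = n * count_list w a"
  by (induction n) auto

lemma count_uword: "count_list (uword k) GX = Suc k" "count_list (uword k) GY = k"
  by (simp_all add: uword_def count_list_concat_replicate)

lemma length_uword: "length (uword k) = 2 * k + 1"
  by (induction k) (auto simp: uword_def)

lemma uword_square_neq:
  assumes "k \<ge> 1"
  shows "uword k @ uword k \<noteq> [GX, GY]" "uword k @ uword k \<noteq> [GY, GX]"
proof -
  have "length (uword k @ uword k) > 2"
    using assms by (simp add: length_uword)
  then show "uword k @ uword k \<noteq> [GX, GY]" "uword k @ uword k \<noteq> [GY, GX]"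
    by (metis One_nat_def Suc_1 length_Cons less_irrefl list.size(3))+
qed

lemma lookup_gpoly:
  assumes "k \<ge> 1"
  shows "Poly_Mapping.lookup (gpoly k) w =
    (if w \<in> {uword k @ uword k, [GX, GY], [GY, GX]} then 1 else 0)"
  using uword_square_neq[OF assms] by (auto simp: gpoly_def lookup_add lookup_single when_def)

lemma keys_gpoly:
  "k \<ge> 1 \<Longrightarrow> Poly_Mapping.keys (gpoly k :: (gen, 'k::idom) free_alg) =
    {uword k @ uword k, [GX, GY], [GY, GX]}"
  by (simp add: set_eq_iff in_keys_iff lookup_gpoly)

text \<open>
  Up to scaling, these are the only weights of \<open>x\<close> and \<open>y\<close> for which the words \<open>u\<^sup>2\<close> and \<open>xy\<close> of
  \<open>g\<close> have the same weight.
\<close>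

definition wt :: "nat \<Rightarrow> gen list \<Rightarrow> int" where
  "wt k w = (2 * int k - 1) * int (count_list w GX) - (2 * int k + 1) * int (count_list w GY)"

lemma wt_append: "wt k (p @ q) = wt k p + wt k q"
  by (simp add: wt_def algebra_simps)

lemma wt_uword: "wt k (uword k) = - 1"
  by (simp add: wt_def count_uword algebra_simps)

lemma wt_uword_power: "wt k (concat (replicate m (uword k))) = - int m"
  by (induction m) (simp_all add: wt_append wt_uword, simp add: wt_def)

lemma homogeneous_gpoly:
  "k \<ge> 1 \<Longrightarrow> homogeneous (wt k) (- 2) (gpoly k :: (gen, 'k::idom) free_alg)"
  by (auto simp: homogeneous_def keys_gpoly wt_append wt_uword) (simp_all add: wt_def)

lemma deglex_rank_uword_square:
  assumes "k \<ge> 1"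
  shows "deglex_rank (uword k @ uword k) > 5"
proof -
  have "(2::nat) ^ 6 \<le> 2 ^ length (uword k @ uword k)"
    using assms by (intro power_increasing) (simp_all add: length_uword)
  then show ?thesis
    using deglex_rank_bounds(1)[of "uword k @ uword k"] by simp
qed

lemma leading_gpoly:
  assumes "k \<ge> 1"
  shows "leading (\<lambda>w. int (deglex_rank w)) (gpoly k :: (gen, 'k::idom) free_alg) (uword k @ uword k)"
    and "leading (\<lambda>w. - int (deglex_rank w)) (gpoly k :: (gen, 'k::idom) free_alg) [GX, GY]"
  using deglex_rank_uword_square[OF assms] by (auto simp: leading_def keys_gpoly[OF assms])

text \<open>
  Commuting words are powers of a common word. Here \<open>u\<^sup>2\<close> is at most a square, because the numbers
  of occurrences of \<open>x\<close> and \<open>y\<close> in \<open>u\<^sup>2\<close> differ by 2.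
\<close>

lemma commutes_with_uword_square:
  assumes "p @ (uword k @ uword k) = (uword k @ uword k) @ p"
  shows "\<exists>m. p = concat (replicate m (uword k))"
proof -
  obtain m n z where m: "p = concat (replicate m z)" and n: "uword k @ uword k = concat (replicate n z)"
    using comm_append_are_replicate[OF assms] by metis
  have "2 * Suc k = n * count_list z GX" "2 * k = n * count_list z GY"
    using arg_cong[OF n, of "\<lambda>w. count_list w GX"] arg_cong[OF n, of "\<lambda>w. count_list w GY"]
    by (simp_all add: count_list_concat_replicate count_uword)
  then have "n dvd 2 * Suc k" "n dvd 2 * k"
    by simp_all
  then have "n dvd 2 * Suc k - 2 * k"
    by (rule dvd_diff_nat)
  then have "n dvd 2" by simp
  then have "n = 1 \<or> n = 2"
    using dvd_imp_le[of n 2] by (cases "n = 0") auto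
  then show ?thesis
  proof
    assume "n = 1"
    then have "p = concat (replicate m (concat (replicate 2 (uword k))))"
      using m n by (simp add: numeral_2_eq_2)
    also have "\<dots> = concat (replicate (m * 2) (uword k))"
      by (induction m) (simp_all add: numeral_2_eq_2)
    finally show ?thesis by blast
  next
    assume "n = 2"
    then have "uword k @ uword k = z @ z" using n by (simp add: numeral_2_eq_2)
    then have "uword k = z"
      by (metis append_eq_append_conv length_append add_self_div_2)
    then show ?thesis using m by blast
  qed
qed

text \<open>
  This is the rigidity of the centralizer: the weight of an element determines its leading word,
  so two elements of the same weight are proportional.
\<close>

lemma leading_word_of_centralizer_element:
  fixes f :: "(gen, 'k::idom) free_alg"
  assumes k: "k \<ge> 1" and f: "f \<in> centralizer (gpoly k)" "homogeneous (wt k) c f" "f \<noteq> 0"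
  shows "\<exists>m. c = - int m \<and> leading (\<lambda>w. int (deglex_rank w)) f (concat (replicate m (uword k)))"
proof -
  obtain p where p: "leading (\<lambda>w. int (deglex_rank w)) f p"
    using leading_exists[OF f(3)] by blast
  have "p @ (uword k @ uword k) = (uword k @ uword k) @ p"
    using leading_commute[OF word_order_deglex(1) p leading_gpoly(1)[OF k]] f(1)
    by (simp add: centralizer_def)
  then obtain m where m: "p = concat (replicate m (uword k))"
    using commutes_with_uword_square by blast
  have "c = wt k p" using f(2) p by (auto simp: homogeneous_def leading_def)
  then show ?thesis using p m wt_uword_power by auto
qed

text \<open>
  Subtracting the right multiple of a power of \<open>g\<close> cancels the coefficient of the only
  possible leading word.
\<close>

lemma centralizer_component_even:
  fixes f :: "(gen, 'k::idom) free_alg"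
  assumes k: "k \<ge> 1" and f: "f \<in> centralizer (gpoly k)" "homogeneous (wt k) (- 2 * int n) f"
  shows "f = const (Poly_Mapping.lookup f (concat (replicate (2 * n) (uword k)))) * gpoly k ^ n"
proof (rule ccontr)
  let ?p = "concat (replicate (2 * n) (uword k))"
  define h where "h = f - const (Poly_Mapping.lookup f ?p) * gpoly k ^ n"
  assume "\<not> ?thesis"
  then have "h \<noteq> 0" by (simp add: h_def)
  moreover have "h \<in> centralizer (gpoly k)"
    unfolding h_def
    by (intro unital_subalgebra_closed unital_subalgebra_centralizer f(1)) (simp add: centralizer_def)
  moreover have "homogeneous (wt k) (- 2 * int n) h"
    unfolding h_def using homogeneous_power[OF wt_append homogeneous_gpoly[OF k], of n]
    by (intro homogeneous_diff f(2) homogeneous_const_times) (simp add: mult.commute)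
  ultimately obtain m where m: "- 2 * int n = - int m"
    "leading (\<lambda>w. int (deglex_rank w)) h (concat (replicate m (uword k)))"
    using leading_word_of_centralizer_element[OF k] by blast
  then have "m = 2 * n" by simp
  with m(2) have "Poly_Mapping.lookup h ?p \<noteq> 0"
    by (simp add: leading_def in_keys_iff)
  moreover have "concat (replicate n (uword k @ uword k)) = ?p"
    by (induction n) simp_all
  then have "Poly_Mapping.lookup (gpoly k ^ n :: (gen, 'k) free_alg) ?p = 1"
    using leading_power(2)[OF word_order_deglex(1) leading_gpoly(1)[OF k, where 'k = 'k], of n]
    by (simp add: lookup_gpoly[OF k])
  then have "Poly_Mapping.lookup h ?p = 0"
    by (simp add: h_def lookup_minus lookup_const_times)
  ultimately show False by simp
qed

text \<open>
  The square of \<open>f\<close> has even weight and hence is a multiple of \<open>g\<^sup>n\<close>. Greatest words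
  give no contradiction, since that of \<open>g\<^sup>n\<close> is the square of \<open>u\<^sup>n\<close>; the least word \<open>(xy)\<^sup>n\<close> of
  \<open>g\<^sup>n\<close> however is not a square for odd \<open>n\<close>.
\<close>

lemma centralizer_component_odd:
  fixes f :: "(gen, 'k::idom) free_alg"
  assumes k: "k \<ge> 1" and f: "f \<in> centralizer (gpoly k)" "homogeneous (wt k) (- int n) f"
    and n: "odd n"
  shows "f = 0"
proof (rule ccontr)
  assume nz: "f \<noteq> 0"
  let ?\<kappa> = "\<lambda>w. - int (deglex_rank w)"
  obtain p where p: "leading ?\<kappa> f p"
    using leading_exists[OF nz] by blast
  obtain a where a: "f * f = const a * gpoly k ^ n"
  proof (rule that, rule centralizer_component_even[OF k])
    show "f * f \<in> centralizer (gpoly k)"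
      using f(1) unital_subalgebra_centralizer[of "gpoly k :: (gen, 'k) free_alg"]
      unfolding unital_subalgebra_def by blast
    show "homogeneous (wt k) (- 2 * int n) (f * f)"
      using homogeneous_times[OF wt_append f(2) f(2)] by simp
  qed
  have pp: "leading ?\<kappa> (f * f) (p @ p)"
    using leading_times(1)[OF word_order_deglex(2) p p] by (simp add: plus_list_def)
  then have "a \<noteq> 0"
    unfolding a by (auto simp: leading_def in_keys_iff lookup_const_times)
  then have "leading ?\<kappa> (f * f) (concat (replicate n [GX, GY]))"
    using leading_power(1)[OF word_order_deglex(2) leading_gpoly(2)[OF k, where 'k = 'k], of n]
    unfolding a by (auto simp: leading_def in_keys_iff lookup_const_times)
  then have "p @ p = concat (replicate n [GX, GY])"
    using leading_unique[OF word_order_deglex(2) pp] by blast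
  from arg_cong[OF this, of "\<lambda>w. count_list w GX"] have "2 * count_list p GX = n"
    by (simp add: count_list_concat_replicate)
  then show False using n by auto
qed

lemma generates_centralizer_gpoly:
  assumes k: "k \<ge> 1"
  shows "generates_centralizer (gpoly k :: (gen, 'k::idom) free_alg)"
  unfolding generates_centralizer_def
proof
  let ?g = "gpoly k :: (gen, 'k) free_alg"
  show "generated_subalgebra ?g \<subseteq> centralizer ?g"
    unfolding generated_subalgebra_def
    by (rule hull_minimal) (simp_all add: unital_subalgebra_centralizer, simp add: centralizer_def)
  show "centralizer ?g \<subseteq> generated_subalgebra ?g"
    unfolding generated_subalgebra_def hull_def
  proof (intro subsetI InterI, clarify)
    fix f A assume f: "f \<in> centralizer ?g" and A: "unital_subalgebra A" "{?g} \<subseteq> A"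
    have "weight_component (wt k) c f \<in> A" for c
    proof (cases "weight_component (wt k) c f = 0")
      case True
      then show ?thesis
        using unital_subalgebra_closed(2)[OF A(1), of "{}" "\<lambda>_. 0"] by simp
    next
      case False
      let ?h = "weight_component (wt k) c f"
      have h: "?h \<in> centralizer ?g" "homogeneous (wt k) c ?h"
        by (simp_all add: weight_component_in_centralizer[OF wt_append homogeneous_gpoly[OF k] f]
            homogeneous_weight_component)
      obtain m where m: "c = - int m"
        using leading_word_of_centralizer_element[OF k h False] by blast
      then have "even m"
        using centralizer_component_odd[OF k h(1), of m] h(2) False by auto
      then obtain n where "m = 2 * n" ..
      then obtain a where "?h = const a * ?g ^ n"
        using centralizer_component_even[OF k h(1), of n] h(2) m by auto
      then show ?thesis
        using unital_subalgebra_closed(1)[OF A(1)] A(2) by simp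
    qed
    then have "(\<Sum>c\<in>wt k ` Poly_Mapping.keys f. weight_component (wt k) c f) \<in> A"
      by (rule unital_subalgebra_closed(2)[OF A(1)])
    then show "f \<in> A" by (simp add: sum_weight_components)
  qed
qed


section \<open>The square root in the Malcev--Neumann algebra\<close>

lemma graded_group_orderD:
  assumes "graded_group_order r"
  shows "(a, b) \<in> r \<Longrightarrow> (b, c) \<in> r \<Longrightarrow> (a, c) \<in> r"
    and "(a, b) \<in> r \<Longrightarrow> (b, a) \<in> r \<Longrightarrow> a = b"
    and "(a, b) \<in> r \<or> (b, a) \<in> r"
    and "(a, b) \<in> r \<Longrightarrow> (c + a, c + b) \<in> r"
    and "(a, b) \<in> r \<Longrightarrow> (a + c, b + c) \<in> r"
    and "deg a < deg b \<Longrightarrow> (a, b) \<in> r"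
    and "(a, b) \<in> r \<Longrightarrow> deg a \<le> deg b"
proof -
  have r: "linear_order r" using assms by (simp add: graded_group_order_def)
  show "(a, c) \<in> r" if "(a, b) \<in> r" "(b, c) \<in> r" for a b c
    using r that by (auto simp: order_on_defs trans_def)
  show antisym: "a = b" if "(a, b) \<in> r" "(b, a) \<in> r" for a b
    using r that by (auto simp: order_on_defs antisym_def)
  show "(a, b) \<in> r \<or> (b, a) \<in> r" for a b
    using r by (cases "a = b") (auto simp: order_on_defs total_on_def refl_on_def)
  show "(c + a, c + b) \<in> r" "(a + c, b + c) \<in> r" if "(a, b) \<in> r" for a b c
    using assms that unfolding graded_group_order_def by blast+
  show less: "(a, b) \<in> r" if "deg a < deg b" for a b
    using assms that unfolding graded_group_order_def by blast
  show "deg a \<le> deg b" if "(a, b) \<in> r" for a b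
    using less[of b a] antisym[of a b] that by force
qed

lemma deg_minus: "deg (- a) = - deg a"
proof -
  have "deg (a + - a) = 0" by (simp add: deg_def zero_free_group.rep_eq)
  then show ?thesis unfolding deg_add by simp
qed

lemma deg_of_word: "deg (of_word w) = int (length w)"
proof -
  have "(\<Sum>l\<leftarrow>map (\<lambda>a. (a, True)) w. if snd l then 1 else - 1) = int (length w)"
    by (induction w) simp_all
  then show ?thesis by (simp add: deg_def of_word.rep_eq)
qed

lemma no_negative_power_of_word: "\<not> has_negative_power (of_word w)"
  by (auto simp: has_negative_power_def of_word.rep_eq)

lemma inj_of_word: "inj of_word"
proof
  fix v w :: "'a list" assume "of_word v = of_word w"
  then have "map (\<lambda>a. (a, True)) v = map (\<lambda>a. (a, True)) w"
    by (metis of_word.rep_eq)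
  then show "v = w" by (simp add: inj_map_eq_map inj_def)
qed

lemma to_series_of_word: "to_series f (of_word w) = Poly_Mapping.lookup f w"
proof -
  have "{v \<in> Poly_Mapping.keys f. of_word v = of_word w} = Poly_Mapping.keys f \<inter> {w}"
    using inj_of_word by (auto simp: inj_def)
  then have "to_series f (of_word w) = sum (Poly_Mapping.lookup f) (Poly_Mapping.keys f \<inter> {w})"
    by (simp add: to_series_def)
  then show ?thesis by (cases "w \<in> Poly_Mapping.keys f") (simp_all add: in_keys_iff)
qed

lemma to_series_outside: "z \<notin> range of_word \<Longrightarrow> to_series f z = 0"
  by (auto simp: to_series_def intro!: sum.neutral)

lemma to_series_gpoly:
  assumes "k \<ge> 1"
  shows "to_series (gpoly k :: (gen, 'k::field) free_alg) z =
    (if z \<in> of_word ` {uword k @ uword k, [GX, GY], [GY, GX]} then 1 else 0)"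
proof (cases "z \<in> range of_word")
  case True
  then obtain w where z: "z = of_word w" by blast
  show ?thesis
    unfolding z to_series_of_word lookup_gpoly[OF assms] inj_image_mem_iff[OF inj_of_word] ..
next
  case False
  then show ?thesis by (auto simp: to_series_outside)
qed

lemma series_mult_nonzero:
  assumes "series_mult \<sigma> \<tau> z \<noteq> 0"
  obtains a b where "\<sigma> a \<noteq> 0" "\<tau> b \<noteq> 0" "z = a + b"
proof -
  have "{(a, b). \<sigma> a \<noteq> 0 \<and> \<tau> b \<noteq> 0 \<and> a + b = z} \<noteq> {}"
    using assms unfolding series_mult_def by (metis sum.empty)
  then show ?thesis using that by blast
qed

text \<open>
  If products of two terms of \<open>\<rho>\<close> other than the one at \<open>U\<close> do not reach \<open>z\<close>, only the part of
  \<open>\<rho>\<^sup>2\<close> that is linear in the remaining terms contributes to the coefficient at \<open>z\<close>.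
\<close>

lemma square_coefficient:
  fixes \<rho> :: "'g::group_add \<Rightarrow> 'k::comm_ring"
  assumes "\<And>a b. a \<noteq> U \<Longrightarrow> b \<noteq> U \<Longrightarrow> \<rho> a \<noteq> 0 \<Longrightarrow> \<rho> b \<noteq> 0 \<Longrightarrow> a + b \<noteq> z"
    and "z \<noteq> U + U"
  shows "series_mult \<rho> \<rho> z = \<rho> U * (\<rho> (- U + z) + \<rho> (z - U))"
proof -
  let ?P = "{(a, b). \<rho> a \<noteq> 0 \<and> \<rho> b \<noteq> 0 \<and> a + b = z}"
  have ne: "U \<noteq> z - U" using assms(2) by (metis diff_add_cancel)
  have "series_mult \<rho> \<rho> z = (\<Sum>(a, b)\<in>{(U, - U + z), (z - U, U)}. \<rho> a * \<rho> b)"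
    unfolding series_mult_def
  proof (rule sum.mono_neutral_left)
    show "?P \<subseteq> {(U, - U + z), (z - U, U)}"
    proof
      fix p assume "p \<in> ?P"
      then obtain a b where p: "p = (a, b)" "\<rho> a \<noteq> 0" "\<rho> b \<noteq> 0" "a + b = z"
        by blast
      then consider "a = U" | "b = U" using assms(1)[of a b] by blast
      then show "p \<in> {(U, - U + z), (z - U, U)}"
        by cases (use p in auto)
    qed
    show "\<forall>i\<in>{(U, - U + z), (z - U, U)} - ?P. (case i of (a, b) \<Rightarrow> \<rho> a * \<rho> b) = 0"
      by (auto simp: add.assoc[symmetric])
  qed simp
  also have "\<dots> = \<rho> U * (\<rho> (- U + z) + \<rho> (z - U))"
    using ne by (simp add: algebra_simps)
  finally show ?thesis .
qed

text \<open>
  The operator \<open>\<beta> \<mapsto> U \<beta> + \<beta> U\<close> has no kernel among series with a greatest monomial \<open>q\<close>. In the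
  larger of the two products \<open>U + q\<close> and \<open>q + U\<close> the coefficient of \<open>q\<close> meets either nothing else or
  itself, and twice a nonzero coefficient is nonzero in characteristic zero.
\<close>

lemma top_coefficient_zero:
  fixes \<beta> :: "'a free_group \<Rightarrow> 'k::field_char_0"
  assumes r: "graded_group_order r"
    and above: "\<And>a. (q, a) \<in> r \<Longrightarrow> a \<noteq> q \<Longrightarrow> \<beta> a = 0"
    and eq: "\<And>z. z = U + q \<or> z = q + U \<Longrightarrow> \<beta> (- U + z) + \<beta> (z - U) = 0"
  shows "\<beta> q = 0"
proof -
  have double: "\<beta> q = 0" if "\<beta> q + \<beta> a = 0" "(q, a) \<in> r" for a
  proof (cases "a = q")
    case True
    then have "2 * \<beta> q = 0" using that(1) mult_2[of "\<beta> q"] by metis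
    then show ?thesis by simp
  next
    case False
    then show ?thesis using that above by simp
  qed
  consider "(q + U, U + q) \<in> r" | "(U + q, q + U) \<in> r"
    using graded_group_orderD(3)[OF r] by blast
  then show ?thesis
  proof cases
    case 1
    then have "(q + U + - U, U + q + - U) \<in> r"
      by (rule graded_group_orderD(5)[OF r])
    then have "(q, U + q - U) \<in> r" by (simp add: add.assoc)
    moreover have "\<beta> q + \<beta> (U + q - U) = 0"
      using eq[of "U + q"] by (simp add: add.assoc[symmetric])
    ultimately show ?thesis by (rule double[rotated])
  next
    case 2
    then have "(- U + (U + q), - U + (q + U)) \<in> r"
      by (rule graded_group_orderD(4)[OF r])
    then have "(q, - U + (q + U)) \<in> r" by (simp add: add.assoc[symmetric])
    moreover have "\<beta> q + \<beta> (- U + (q + U)) = 0"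
      using eq[of "q + U"] by (simp add: add.commute)
    ultimately show ?thesis by (rule double[rotated])
  qed
qed

lemma opposite_well_ordered_insert:
  assumes r: "graded_group_order r" and D: "opposite_well_ordered r D"
  shows "opposite_well_ordered r (insert t D)"
  unfolding opposite_well_ordered_def
proof (intro allI impI)
  fix S assume S: "S \<subseteq> insert t D" "S \<noteq> {}"
  have tt: "(t, t) \<in> r" using graded_group_orderD(3)[OF r] by blast
  have D_max: "\<exists>m\<in>T. \<forall>z\<in>T. (z, m) \<in> r" if "T \<subseteq> D" "T \<noteq> {}" for T
    using D that unfolding opposite_well_ordered_def by blast
  consider "S \<subseteq> D" | "S = {t}" | "t \<in> S" "S - {t} \<noteq> {}" "S - {t} \<subseteq> D"
    using S by blast
  then show "\<exists>m\<in>S. \<forall>z\<in>S. (z, m) \<in> r"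
  proof cases
    case 1
    then show ?thesis using D_max S(2) by blast
  next
    case 2
    then show ?thesis using tt by simp
  next
    case 3
    then obtain m where m: "m \<in> S - {t}" "\<And>z. z \<in> S - {t} \<Longrightarrow> (z, m) \<in> r"
      using D_max[of "S - {t}"] by blast
    show ?thesis
    proof (cases "(t, m) \<in> r")
      case True
      then have "\<forall>z\<in>S. (z, m) \<in> r" using m(2) by blast
      then show ?thesis using m(1) by blast
    next
      case False
      then have "(m, t) \<in> r" using graded_group_orderD(3)[OF r] by blast
      then have "\<forall>z\<in>S. (z, t) \<in> r"
        using m(2) tt graded_group_orderD(1)[OF r] by blast
      then show ?thesis using 3(1) by blast
    qed
  qed
qed

text \<open>
  The greatest monomial of a square is twice the greatest monomial of the root, and doubling is
  injective in an ordered group.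
\<close>

lemma square_leading_term:
  fixes \<rho> :: "'a free_group \<Rightarrow> 'k::field"
  assumes r: "graded_group_order r"
    and \<rho>: "opposite_well_ordered r {z. \<rho> z \<noteq> 0}"
    and UU: "series_mult \<rho> \<rho> (U + U) \<noteq> 0"
    and top: "\<And>z. series_mult \<rho> \<rho> z \<noteq> 0 \<Longrightarrow> (z, U + U) \<in> r"
  shows "series_mult \<rho> \<rho> (U + U) = \<rho> U * \<rho> U" and "\<rho> a \<noteq> 0 \<Longrightarrow> (a, U) \<in> r"
proof -
  note ord = graded_group_orderD[OF r]
  obtain b d where bd: "\<rho> b \<noteq> 0" "\<rho> d \<noteq> 0" "U + U = b + d"
    using series_mult_nonzero[OF UU] .
  then obtain m where m: "\<rho> m \<noteq> 0" and max: "\<And>a. \<rho> a \<noteq> 0 \<Longrightarrow> (a, m) \<in> r"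
    using \<rho>[unfolded opposite_well_ordered_def, rule_format, OF subset_refl] by blast
  have "{(a, b). \<rho> a \<noteq> 0 \<and> \<rho> b \<noteq> 0 \<and> a + b = m + m} = {(m, m)}"
  proof (intro equalityI subsetI, clarify)
    fix a b assume ab: "\<rho> a \<noteq> 0" "\<rho> b \<noteq> 0" "a + b = m + m"
    have "(a + b, a + m) \<in> r" "(a + m, m + m) \<in> r"
      by (rule ord(4)[OF max[OF ab(2)]], rule ord(5)[OF max[OF ab(1)]])
    then have "a + m = m + m" using ab(3) ord(2) by metis
    then show "a = m \<and> b = m" using ab(3) by simp
  qed (use m in auto)
  then have mm: "series_mult \<rho> \<rho> (m + m) = \<rho> m * \<rho> m"
    by (simp add: series_mult_def)
  have "(b + d, b + m) \<in> r" "(b + m, m + m) \<in> r"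
    by (rule ord(4)[OF max[OF bd(2)]], rule ord(5)[OF max[OF bd(1)]])
  then have "(U + U, m + m) \<in> r" using bd(3) ord(1) by metis
  moreover have "(m + m, U + U) \<in> r" using top mm m by simp
  ultimately have eq: "m + m = U + U" by (rule ord(2)[rotated])
  have double: "a = b" if "(a, b) \<in> r" "a + a = b + b" for a b
  proof -
    have "(a + a, a + b) \<in> r" "(a + b, b + b) \<in> r"
      by (rule ord(4)[OF that(1)], rule ord(5)[OF that(1)])
    then have "a + b = b + b" using that(2) ord(2) by metis
    then show ?thesis by simp
  qed
  have "m = U"
    using ord(3)[of m U] double[OF _ eq] double[OF _ eq[symmetric]] by metis
  then show "series_mult \<rho> \<rho> (U + U) = \<rho> U * \<rho> U" "\<rho> a \<noteq> 0 \<Longrightarrow> (a, U) \<in> r"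
    using mm max by auto
qed

text \<open>
  After the leading monomial \<open>U\<close>, the monomials of \<open>\<rho>\<close> are controlled in two rounds. First, no
  other monomial has degree above \<open>2 - deg U\<close>: for the greatest one \<open>q\<close>, both \<open>U + q\<close> and \<open>q + U\<close> exceed
  \<open>q + q\<close>, so they see only the linear part, while \<open>\<rho>\<^sup>2\<close> vanishes there. Secondly, once this degree
  bound is known, \<open>\<rho>\<^sup>2\<close> is linear in the terms after \<open>U\<close> in all degrees above \<open>4 - 2 deg U\<close>; the
  candidate \<open>t = - U + V\<close> accounts for \<open>V\<close> and \<open>W\<close>, and what is left is annihilated by the
  linear operator.
\<close>

lemma square_root_support:
  fixes \<rho> :: "'a free_group \<Rightarrow> 'k::field_char_0"
  assumes r: "graded_group_order r"
    and \<rho>: "opposite_well_ordered r {z. \<rho> z \<noteq> 0}"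
    and sq: "\<And>z. series_mult \<rho> \<rho> z = (if z \<in> {U + U, V, W} then 1 else 0)"
    and deg: "deg U \<ge> 4" "deg V = 2" "deg W = 2"
    and VW: "V \<noteq> W" "V + U = U + W"
    and a: "\<rho> a \<noteq> 0" "deg a > - 2 * deg U"
  shows "a = U \<or> a = - U + V"
proof -
  note ord = graded_group_orderD[OF r]
  define n where "n = deg U"
  define t where "t = - U + V"
  have deg_t: "deg t = 2 - n" by (simp add: t_def n_def deg_add deg_minus deg)
  have t: "U + t = V" "t + U = W"
    using VW(2) by (simp_all add: t_def add.assoc minus_add_cancel add_minus_cancel)
  have UU: "series_mult \<rho> \<rho> (U + U) \<noteq> 0" by (simp add: sq)
  have top: "(z, U + U) \<in> r" if "series_mult \<rho> \<rho> z \<noteq> 0" for z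
  proof -
    have "(U + U, U + U) \<in> r" using ord(3) by blast
    then show ?thesis
      using that deg ord(6)[of z "U + U"] by (auto simp: sq deg_add split: if_splits)
  qed
  have c: "\<rho> U * \<rho> U = 1" and below: "\<And>a. \<rho> a \<noteq> 0 \<Longrightarrow> (a, U) \<in> r"
    using square_leading_term[OF r \<rho> UU top] by (simp_all add: sq)
  then have c0: "\<rho> U \<noteq> 0" by auto
  have shift: "- U + z = b \<longleftrightarrow> z = U + b" "z - U = b \<longleftrightarrow> z = b + U" for z b
    by (auto simp: add.assoc[symmetric] diff_eq_eq)

  have low: "deg a \<le> 2 - n" if a: "\<rho> a \<noteq> 0" "a \<noteq> U" for a
  proof (rule ccontr)
    assume nle: "\<not> deg a \<le> 2 - n"
    have "{z. \<rho> z \<noteq> 0 \<and> z \<noteq> U} \<noteq> {}" using a by blast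
    then obtain q where q: "\<rho> q \<noteq> 0" "q \<noteq> U"
      and max: "\<And>b. \<rho> b \<noteq> 0 \<Longrightarrow> b \<noteq> U \<Longrightarrow> (b, q) \<in> r"
      using \<rho> unfolding opposite_well_ordered_def
      by (smt (verit) mem_Collect_eq subsetI)
    have deg_q: "deg q > 2 - n" using ord(7)[OF max[OF a]] nle by simp
    define \<beta> where "\<beta> = \<rho>(U := 0)"
    have "\<beta> q = 0"
    proof (rule top_coefficient_zero[OF r])
      show "\<beta> b = 0" if "(q, b) \<in> r" "b \<noteq> q" for b
        using max[of b] ord(2)[of q b] that by (auto simp: \<beta>_def)
      fix z assume z: "z = U + q \<or> z = q + U"
      then have zUU: "z \<noteq> U + U" using q by auto
      have "(q + q, U + q) \<in> r" "(q + q, q + U) \<in> r"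
        by (rule ord(5)[OF below[OF q(1)]], rule ord(4)[OF below[OF q(1)]])
      then have "(q + q, z) \<in> r" and zqq: "z \<noteq> q + q"
        using z q(2) by auto
      have "b + d \<noteq> z" if "b \<noteq> U" "d \<noteq> U" "\<rho> b \<noteq> 0" "\<rho> d \<noteq> 0" for b d
      proof
        assume "b + d = z"
        moreover have "(b + d, b + q) \<in> r" "(b + q, q + q) \<in> r"
          by (rule ord(4)[OF max[OF that(4,2)]], rule ord(5)[OF max[OF that(3,1)]])
        ultimately have "(z, q + q) \<in> r" using ord(1) by metis
        then show False using \<open>(q + q, z) \<in> r\<close> zqq ord(2) by metis
      qed
      then have "series_mult \<rho> \<rho> z = \<rho> U * (\<rho> (- U + z) + \<rho> (z - U))"
        using zUU by (intro square_coefficient) auto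
      moreover have "deg z > 2" using z deg_q by (auto simp: deg_add n_def)
      then have "series_mult \<rho> \<rho> z = 0" using zUU deg by (auto simp: sq)
      ultimately show "\<beta> (- U + z) + \<beta> (z - U) = 0"
        using c0 zUU by (simp add: \<beta>_def shift)
    qed
    then show False using q by (simp add: \<beta>_def)
  qed

  \<comment> \<open>The coefficient of \<open>t\<close> should be the inverse of \<open>\<rho> U\<close>, which is \<open>\<rho> U\<close> itself by \<open>c\<close>.\<close>
  define \<beta> where "\<beta> = \<rho>(U := 0, t := \<rho> t - \<rho> U)"
  have tU: "t \<noteq> U" using deg_t deg n_def by auto
  have "\<beta> a = 0" if a: "deg a > - 2 * n" for a
  proof (rule ccontr)
    assume "\<beta> a \<noteq> 0"
    then have ne: "{b. \<beta> b \<noteq> 0 \<and> deg b > - 2 * n} \<noteq> {}" using a by blast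
    have sub: "{b. \<beta> b \<noteq> 0 \<and> deg b > - 2 * n} \<subseteq> insert t {z. \<rho> z \<noteq> 0}"
      by (auto simp: \<beta>_def split: if_splits)
    \<comment> \<open>\<open>t\<close> is inserted because \<open>\<beta>\<close> may be nonzero there even where \<open>\<rho>\<close> vanishes.\<close>
    obtain q where q: "\<beta> q \<noteq> 0" "deg q > - 2 * n"
      and max: "\<And>b. \<beta> b \<noteq> 0 \<Longrightarrow> deg b > - 2 * n \<Longrightarrow> (b, q) \<in> r"
      using opposite_well_ordered_insert[OF r \<rho>, of t] ne sub
      unfolding opposite_well_ordered_def by (smt (verit) mem_Collect_eq)
    have deg_q: "deg q \<le> 2 - n"
      using q(1) low[of q] deg_t by (auto simp: \<beta>_def split: if_splits)
    have "\<beta> q = 0"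
    proof (rule top_coefficient_zero[OF r])
      show "\<beta> b = 0" if "(q, b) \<in> r" "b \<noteq> q" for b
        using max[of b] ord(2)[of q b] ord(7)[of q b] q(2) that by force
      fix z assume z: "z = U + q \<or> z = q + U"
      then have deg_z: "deg z = n + deg q" by (auto simp: deg_add n_def)
      then have zUU: "z \<noteq> U + U" using deg_q deg by (auto simp: deg_add n_def)
      have "b + d \<noteq> z" if "b \<noteq> U" "d \<noteq> U" "\<rho> b \<noteq> 0" "\<rho> d \<noteq> 0" for b d
      proof
        assume "b + d = z"
        then have "deg z \<le> 4 - 2 * n"
          using low[of b] low[of d] that by (auto simp: deg_add)
        \<comment> \<open>\<open>deg z > - n \<ge> 4 - 2 n\<close>; this is where \<open>deg U \<ge> 4\<close> matters.\<close>
        then show False using deg_z q(2) deg n_def by linarith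
      qed
      then have "series_mult \<rho> \<rho> z = \<rho> U * (\<rho> (- U + z) + \<rho> (z - U))"
        using zUU by (intro square_coefficient) auto
      moreover define \<epsilon> :: 'k where "\<epsilon> = (if z = V then 1 else 0) + (if z = W then 1 else 0)"
      moreover have "series_mult \<rho> \<rho> z = \<epsilon>"
        using zUU VW(1) by (simp add: sq \<epsilon>_def)
      moreover have "\<beta> (- U + z) + \<beta> (z - U) = \<rho> (- U + z) + \<rho> (z - U) - \<rho> U * \<epsilon>"
        using zUU tU t VW(1) by (auto simp: \<beta>_def shift \<epsilon>_def)
      ultimately have "\<rho> U * (\<beta> (- U + z) + \<beta> (z - U)) = \<epsilon> - \<rho> U * \<rho> U * \<epsilon>"
        by (simp add: right_diff_distrib mult.assoc)
      then have "\<rho> U * (\<beta> (- U + z) + \<beta> (z - U)) = 0" using c by simp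
      then show "\<beta> (- U + z) + \<beta> (z - U) = 0" using c0 by simp
    qed
    then show False using q by simp
  qed
  then have "\<beta> a = 0" using a(2) by (simp add: n_def)
  then show ?thesis using a(1) by (auto simp: \<beta>_def t_def split: if_splits)
qed

lemma malcev_neumann_powers:
  fixes \<rho> :: "'a free_group \<Rightarrow> 'k::field"
  shows "\<rho> [^]\<^bsub>malcev_neumann r\<^esub> (2::nat) = series_mult \<rho> \<rho>"
    and "\<rho> [^]\<^bsub>malcev_neumann r\<^esub> (3::nat) = series_mult (series_mult \<rho> \<rho>) \<rho>"
proof -
  have "series_mult (\<lambda>z. if z = 0 then 1 else 0) \<rho> = \<rho>"
  proof
    fix z
    have "{(a, b). (if a = 0 then 1 else 0 :: 'k) \<noteq> 0 \<and> \<rho> b \<noteq> 0 \<and> a + b = z} =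
        (if \<rho> z = 0 then {} else {(0, z)})"
      by (auto split: if_splits)
    then show "series_mult (\<lambda>z. if z = 0 then 1 else 0) \<rho> z = \<rho> z"
      unfolding series_mult_def by simp
  qed
  then show "\<rho> [^]\<^bsub>malcev_neumann r\<^esub> (2::nat) = series_mult \<rho> \<rho>"
    "\<rho> [^]\<^bsub>malcev_neumann r\<^esub> (3::nat) = series_mult (series_mult \<rho> \<rho>) \<rho>"
    by (simp_all add: nat_pow_def numeral_2_eq_2 numeral_3_eq_3 malcev_neumann_def)
qed

text \<open>
  A monomial of \<open>\<rho>\<^sup>3 = g \<rho>\<close> is the product of a word of \<open>g\<close>, of degree at most \<open>2 deg U\<close>, and a
  monomial of \<open>\<rho>\<close>; in positive degree the latter has degree above \<open>- 2 deg U\<close> and is known.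
  The factor \<open>- U + V\<close> has degree \<open>1 - 2k\<close>, below \<open>- 2\<close>, so it can only follow \<open>U + U\<close>, which absorbs its
  inverse letters.
\<close>

lemma cube_of_square_root:
  fixes \<rho> :: "gen free_group \<Rightarrow> 'k::field_char_0"
  assumes k: "k \<ge> 2" and r: "graded_group_order r"
    and \<rho>: "\<rho> \<in> carrier (malcev_neumann r)"
    and sq: "to_series (gpoly k) = \<rho> [^]\<^bsub>malcev_neumann r\<^esub> (2::nat)"
    and z: "(\<rho> [^]\<^bsub>malcev_neumann r\<^esub> (3::nat)) z \<noteq> 0" "deg z > 0"
  shows "\<not> has_negative_power z"
proof -
  define U where "U = of_word (uword k)"
  define V where "V = of_word [GX, GY]"
  define W where "W = of_word [GY, GX]"
  note UVW = U_def V_def W_def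
  have add: "of_word (v @ w) = of_word v + of_word w" for v w :: "gen list"
    using of_word_add[of v w] by (simp add: plus_list_def)
  have g: "to_series (gpoly k :: (gen, 'k) free_alg) z = (if z \<in> {U + U, V, W} then 1 else 0)" for z
    using to_series_gpoly[of k z, where 'k = 'k] k by (simp add: UVW add)
  have deg: "deg U = 2 * int k + 1" "deg V = 2" "deg W = 2"
    by (simp_all add: UVW deg_of_word length_uword)
  have "[GX, GY] @ uword k = uword k @ [GY, GX]"
    unfolding uword_def by (induction k) auto
  then have VU: "V + U = U + W" by (simp add: UVW flip: add)
  have VW: "V \<noteq> W" by (simp add: UVW inj_eq[OF inj_of_word])
  have support: "b = U \<or> b = - U + V" if "\<rho> b \<noteq> 0" "deg b > - 2 * deg U" for b
  proof (rule square_root_support[OF r])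
    show "opposite_well_ordered r {z. \<rho> z \<noteq> 0}" using \<rho> by (simp add: malcev_neumann_def)
    show "series_mult \<rho> \<rho> z = (if z \<in> {U + U, V, W} then 1 else 0)" for z
      using sq g by (simp add: malcev_neumann_powers)
  qed (use that k deg VU VW in auto)
  obtain a b where ab: "to_series (gpoly k :: (gen, 'k) free_alg) a \<noteq> 0" "\<rho> b \<noteq> 0" "z = a + b"
  proof -
    have "series_mult (to_series (gpoly k)) \<rho> z \<noteq> 0"
      using z(1) sq by (simp add: malcev_neumann_powers)
    then show ?thesis using series_mult_nonzero that by blast
  qed
  then have a: "a = U + U \<or> a = V \<or> a = W" by (auto simp: g split: if_splits)
  then have "b = U \<or> b = - U + V"
    using support[OF ab(2)] z(2) ab(3) deg k by (auto simp: deg_add)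
  moreover have "a = U + U" if "b = - U + V"
    using that a z(2) ab(3) deg k by (auto simp: deg_add deg_minus)
  ultimately consider "z = U + U + U" | "z = V + U" | "z = W + U" | "z = U + V"
    using a ab(3) by (auto simp: add.assoc)
  then have "z \<in> range of_word"
    by cases (auto simp: UVW simp flip: add)
  then show ?thesis using no_negative_power_of_word by auto
qed

theorem theorem4p2:
  fixes k :: nat and x y u v w s g :: "(gen, 'k::field_char_0) free_alg"
  assumes "k \<ge> 2"
    and "x = var GX" and "y = var GY"
    and "u = (x * y) ^ k * x" and "v = x * y" and "w = y * x"
    and "s = v + w" and "g = u\<^sup>2 + s"
  shows "generates_centralizer g \<and>
    (\<exists>h. hom_component (max_degree g) g = h\<^sup>2) \<and>
    (\<forall>r. graded_group_order r \<longrightarrow>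
      (\<forall>\<rho> \<in> carrier (malcev_neumann r).
         to_series g = \<rho> [^]\<^bsub>malcev_neumann r\<^esub> (2::nat) \<longrightarrow>
         \<not> (\<exists>z. (\<rho> [^]\<^bsub>malcev_neumann r\<^esub> (3::nat)) z \<noteq> 0 \<and> deg z > 0 \<and> has_negative_power z)))"
proof -
  have xy: "x * y = Poly_Mapping.single [GX, GY] 1" "y * x = Poly_Mapping.single [GY, GX] 1"
    by (simp_all add: assms(2,3) var_def mult_single plus_list_def)
  have single_Nil: "Poly_Mapping.single [] 1 = (1 :: (gen, 'k) free_alg)"
    by (simp flip: zero_list_def)
  have "(x * y) ^ n = Poly_Mapping.single (concat (replicate n [GX, GY])) 1" for n
    unfolding xy by (induction n) (simp_all add: mult_single plus_list_def single_Nil)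
  then have u: "u = Poly_Mapping.single (uword k) 1"
    by (simp add: assms(2,4) var_def mult_single plus_list_def uword_def)
  then have uu: "u\<^sup>2 = Poly_Mapping.single (uword k @ uword k) 1"
    by (simp add: power2_eq_square mult_single plus_list_def)
  have g: "g = gpoly k"
    by (simp add: assms(5-8) uu xy gpoly_def add.assoc)
  have k: "k \<ge> 1" using assms(1) by simp
  have "max_degree g = 4 * k + 2"
    using k by (simp add: max_degree_def g keys_gpoly length_uword)
  moreover have "hom_component (4 * k + 2) g = u\<^sup>2"
    using k uword_square_neq[OF k] by (intro poly_mapping_eqI)
      (auto simp: uu g hom_component.rep_eq lookup_gpoly lookup_single when_def length_uword)
  ultimately have "\<exists>h. hom_component (max_degree g) g = h\<^sup>2" by auto
  moreover have "generates_centralizer g"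
    unfolding g by (rule generates_centralizer_gpoly[OF k])
  ultimately show ?thesis
    using cube_of_square_root[OF assms(1), where 'k = 'k] unfolding g by blast
qed

end
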